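(* Let $\{\mathsf{P}_\theta : \theta \in \mathbb{T}\}$ be a statistical model on $\mathbb{X}$ with relative likelihood $\eta(x,\theta)$, possibility contour $\pi_x(\theta) = \mathsf{P}_\theta\{\eta(X,\theta) \le \eta(x,\theta)\}$, and possibility measure $\overline{\Pi}_x(A) = \sup_{\theta \in A} \pi_x(\theta)$, $A \subseteq \mathbb{T}$. Then the inferential model determined by $\pi_x$ is (strongly) valid, i.e., $$\sup_{\Theta \in \mathbb{T}} \mathsf{P}_\Theta\{ \pi_X(\Theta) \leq \alpha\} \leq \alpha, \quad \text{for all } \alpha \in [0,1],$$ and, consequently, the possibility measure satisfies $$\sup_{\Theta \in \mathbb{T}} \mathsf{P}_\Theta\{ \overline{\Pi}_X(A) \leq \alpha \text{ for some } A \subseteq \mathbb{T} \text{ with } A \ni \Theta \} \leq \alpha, \quad \text{for all } \alpha \in [0,1].$$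
   Context: $X$ denotes observable data taking values in a sample space $\mathbb{X}$. The model is a family $\{\mathsf{P}_\theta : \theta \in \mathbb{T}\}$ of probability distributions on $\mathbb{X}$, indexed by a parameter space $\mathbb{T}$; $\mathsf{P}_\theta\{\cdots\}$ is probability computed with $X \sim \mathsf{P}_\theta$. Each $\mathsf{P}_\theta$ has a probability mass or density function $p_\theta$ on $\mathbb{X}$ (with respect to a common dominating measure). The likelihood at $x \in \mathbb{X}$ is $L_x(\theta) = p_\theta(x)$, and the relative likelihood is $$\eta(x,\theta) = \frac{L_x(\theta)}{\sup_{\vartheta \in \mathbb{T}} L_x(\vartheta)}, \quad x \in \mathbb{X},\ \theta \in \mathbb{T}.$$ It is assumed that $0 < \sup_{\vartheta} L_x(\vartheta) < \infty$ so that $\eta$ is well defined with values in $[0,1]$, and that $x \mapsto \eta(x,\theta)$ is measurable for each $\theta$. The possibility contour is, for fixed $x \in \mathbb{X}$, $$\pi_x(\theta) = \mathsf{P}_\theta\{ \eta(X,\theta) \leq \eta(x,\theta)\}, \quad \theta \in \mathbb{T},$$ where the probability is over $X \sim \mathsf{P}_\theta$ with $x$ held fixed. The associated possibility measure is $\overline{\Pi}_x(A) = \sup_{\theta \in A} \pi_x(\theta)$ for $A \subseteq \mathbb{T}$. $\pi_X(\theta)$ and $\overline{\Pi}_X(A)$ denote these quantities evaluated at the random data $x = X$. The inferential model (IM) is the map $x \mapsto \overline{\Pi}_x$; it is called (strongly) valid if the first displayed inequality of the claim holds. The event in the second display is that there exists at least one subset $A$ of $\mathbb{T}$ containing $\Theta$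 with $\overline{\Pi}_X(A) \le \alpha$. *)

theory Defs
  imports "HOL-Probability.Probability"
begin

definition relative_likelihood :: "'t set \<Rightarrow> ('t \<Rightarrow> 'x \<Rightarrow> real) \<Rightarrow> 'x \<Rightarrow> 't \<Rightarrow> real" where
  "relative_likelihood T p x \<theta> = p \<theta> x / (SUP \<theta>'\<in>T. p \<theta>' x)"

text \<open>
  \<open>T\<close> is the parameter space, \<open>M\<close> the common dominating measure on the sample space \<open>space M\<close>,
  and \<open>p \<theta>\<close> the density of \<open>P \<theta>\<close> with respect to \<open>M\<close> (a mass function if \<open>M\<close> is a counting
  measure). The suprema are real-valued, so finiteness of the supremum of the likelihood is the
  condition \<open>bdd_above\<close>.
\<close>

locale statistical_model =
  fixes T :: "'t set" and M :: "'x measure"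
    and P :: "'t \<Rightarrow> 'x measure" and p :: "'t \<Rightarrow> 'x \<Rightarrow> real"
  assumes T_nonempty: "T \<noteq> {}"
    and prob_space_P: "\<And>\<theta>. \<theta> \<in> T \<Longrightarrow> prob_space (P \<theta>)"
    and p_measurable: "\<And>\<theta>. \<theta> \<in> T \<Longrightarrow> p \<theta> \<in> borel_measurable M"
    and p_nonneg: "\<And>\<theta> x. \<theta> \<in> T \<Longrightarrow> x \<in> space M \<Longrightarrow> 0 \<le> p \<theta> x"
    and P_density: "\<And>\<theta>. \<theta> \<in> T \<Longrightarrow> P \<theta> = density M (\<lambda>x. ennreal (p \<theta> x))"
    and likelihood_bdd: "\<And>x. x \<in> space M \<Longrightarrow> bdd_above ((\<lambda>\<theta>. p \<theta> x) ` T)"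
    and likelihood_sup_pos: "\<And>x. x \<in> space M \<Longrightarrow> 0 < (SUP \<theta>\<in>T. p \<theta> x)"
    and relative_likelihood_measurable:
      "\<And>\<theta>. \<theta> \<in> T \<Longrightarrow> (\<lambda>x. relative_likelihood T p x \<theta>) \<in> borel_measurable M"

definition possibility_contour ::
  "'t set \<Rightarrow> ('t \<Rightarrow> 'x measure) \<Rightarrow> ('t \<Rightarrow> 'x \<Rightarrow> real) \<Rightarrow> 'x \<Rightarrow> 't \<Rightarrow> real" where
  "possibility_contour T P p x \<theta> =
     \<P>(y in P \<theta>. relative_likelihood T p y \<theta> \<le> relative_likelihood T p x \<theta>)"

text \<open>
  Only meaningful for nonempty \<open>A \<subseteq> T\<close>: the supremum of the empty set of reals is unspecified.
\<close>

definition possibility_measure ::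
  "'t set \<Rightarrow> ('t \<Rightarrow> 'x measure) \<Rightarrow> ('t \<Rightarrow> 'x \<Rightarrow> real) \<Rightarrow> 'x \<Rightarrow> 't set \<Rightarrow> real" where
  "possibility_measure T P p x A = (SUP \<theta>\<in>A. possibility_contour T P p x \<theta>)"

text \<open>
  Bounds on probabilities have to be stated together with measurability of the events, because
  \<open>measure\<close> is \<open>0\<close> on non-measurable sets.
\<close>

end

theory Submission
  imports Defs
begin

text \<open>
  Fix \<open>\<theta>\<close> and let \<open>F\<close> be the distribution function of the real random variable
  \<open>\<eta>(X, \<theta>)\<close> under \<open>P \<theta>\<close>. By definition \<open>\<pi>\<^sub>x(\<theta>) = F (\<eta>(x, \<theta>))\<close>, so validity is the statement
  that a random variable inserted into its own distribution function is stochastically at least as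
  large as a uniform one (\<open>prob_cdf_le\<close>). Jumps of \<open>F\<close> do no harm: for \<open>\<alpha> < 1\<close> the set where
  \<open>F \<le> \<alpha>\<close>, if nonempty, is a left ray, and its mass is either a value of \<open>F\<close> on the ray or a limit
  of such values, according to whether the ray contains its endpoint.

  The second claim is about the same event as the first. A supremum over \<open>A\<close> with \<open>\<Theta> \<in> A\<close> is at least
  \<open>\<pi>\<^sub>x(\<Theta>)\<close>, and the choice \<open>A = {\<Theta>}\<close> attains this bound; hence some \<open>A\<close> containing \<open>\<Theta>\<close> has
  possibility at most \<open>\<alpha>\<close> if and only if \<open>\<pi>\<^sub>x(\<Theta>) \<le> \<alpha>\<close>. The uncountable union over \<open>A\<close> therefore
  causes neither a measurability problem nor a loss in the bound.
\<close>

lemma (in finite_borel_measure) borel_measurable_cdf: "cdf M \<in> borel_measurable borel"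
  by (intro borel_measurable_mono monoI cdf_nondecreasing)

text \<open>
  This is an inequality and not an equation because an atom can make \<open>cdf M\<close> jump from below \<open>\<alpha>\<close>
  to above \<open>\<alpha>\<close>; the sublevel set is then an open ray whose mass is the left limit at the jump.
\<close>

lemma (in real_distribution) prob_cdf_le:
  assumes "0 \<le> \<alpha>"
  shows "prob {t. cdf M t \<le> \<alpha>} \<le> \<alpha>"
proof -
  let ?S = "{t. cdf M t \<le> \<alpha>}"
  have down: "u \<in> ?S" if "t \<in> ?S" "u \<le> t" for t u
    using that cdf_nondecreasing[of u t] by simp
  consider "1 \<le> \<alpha>" | "?S = {}" | "\<alpha> < 1" "?S \<noteq> {}" by fastforce
  then show ?thesis
  proof cases
    case 1
    then show ?thesis by (meson order_trans prob_le_1)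
  next
    case 2
    then show ?thesis using assms by (simp only: measure_empty)
  next
    case 3
    have "eventually (\<lambda>t. \<alpha> < cdf M t) at_top"
      using order_tendstoD(1)[OF cdf_lim_at_top_prob 3(1)] .
    then obtain b where "\<alpha> < cdf M b"
      by (auto simp: eventually_at_top_linorder)
    then have "t \<le> b" if "t \<in> ?S" for t
      using down[OF that, of b] by (cases "t \<le> b") auto
    then have bdd: "bdd_above ?S" by (rule bdd_aboveI)
    define s where "s = Sup ?S"
    have le_s: "t \<le> s" if "t \<in> ?S" for t
      unfolding s_def using that bdd by (rule cSup_upper)
    have below: "t \<in> ?S" if "t < s" for t
    proof -
      obtain u where "u \<in> ?S" "t < u"
        using less_cSupD[OF 3(2)] \<open>t < s\<close> unfolding s_def by blast
      then show ?thesis using down by (blast intro: less_imp_le)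
    qed
    show ?thesis
    proof (cases "s \<in> ?S")
      case True
      then have S: "?S = {..s}" using le_s down by blast
      show ?thesis unfolding S using True by (simp add: cdf_def)
    next
      case False
      then have "?S = {..<s}" using le_s below by (auto simp: order_less_le)
      moreover have "measure M {..<s} \<le> \<alpha>"
      proof (rule tendsto_upperbound[OF cdf_at_left])
        show "eventually (\<lambda>t. cdf M t \<le> \<alpha>) (at_left s)"
          using below by (auto simp: eventually_at_filter)
      qed simp
      ultimately show ?thesis by simp
    qed
  qed
qed

context statistical_model
begin

lemma relative_likelihood_rv:
  "\<theta> \<in> T \<Longrightarrow> (\<lambda>x. relative_likelihood T p x \<theta>) \<in> borel_measurable (P \<theta>)"
  using relative_likelihood_measurable by (simp add: P_density)

lemma possibility_contour_eq_cdf: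
  assumes "\<theta> \<in> T"
  shows "possibility_contour T P p x \<theta> =
    cdf (distr (P \<theta>) borel (\<lambda>y. relative_likelihood T p y \<theta>)) (relative_likelihood T p x \<theta>)"
  using relative_likelihood_rv[OF assms]
  by (simp add: possibility_contour_def cdf_def measure_distr vimage_def Int_def conj_commute)

lemma possibility_contour_measurable:
  assumes "\<theta> \<in> T"
  shows "(\<lambda>x. possibility_contour T P p x \<theta>) \<in> borel_measurable (P \<theta>)"
proof -
  interpret P: prob_space "P \<theta>" using assms by (rule prob_space_P)
  interpret D: real_distribution "distr (P \<theta>) borel (\<lambda>y. relative_likelihood T p y \<theta>)"
    using relative_likelihood_rv[OF assms] by (rule P.real_distribution_distr)
  show ?thesis
    unfolding possibility_contour_eq_cdf[OF assms]
    by (rule measurable_compose[OF relative_likelihood_rv[OF assms] D.borel_measurable_cdf])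
qed

lemma prob_possibility_contour_le:
  assumes "\<theta> \<in> T" "0 \<le> \<alpha>"
  shows "\<P>(x in P \<theta>. possibility_contour T P p x \<theta> \<le> \<alpha>) \<le> \<alpha>"
proof -
  let ?\<eta> = "\<lambda>y. relative_likelihood T p y \<theta>"
  interpret P: prob_space "P \<theta>" using assms(1) by (rule prob_space_P)
  interpret D: real_distribution "distr (P \<theta>) borel ?\<eta>"
    using relative_likelihood_rv[OF assms(1)] by (rule P.real_distribution_distr)
  have "{t. cdf (distr (P \<theta>) borel ?\<eta>) t \<le> \<alpha>} \<in> sets borel"
    using D.borel_measurable_cdf by measurable
  then have "\<P>(x in P \<theta>. possibility_contour T P p x \<theta> \<le> \<alpha>) =
      D.prob {t. cdf (distr (P \<theta>) borel ?\<eta>) t \<le> \<alpha>}"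
    using relative_likelihood_rv[OF assms(1)]
    by (simp add: possibility_contour_eq_cdf[OF assms(1)] measure_distr vimage_def Int_def
        conj_commute)
  also have "\<dots> \<le> \<alpha>" using assms(2) by (rule D.prob_cdf_le)
  finally show ?thesis .
qed

lemma ex_possibility_measure_le_iff:
  assumes "\<theta> \<in> T"
  shows "(\<exists>A\<subseteq>T. \<theta> \<in> A \<and> possibility_measure T P p x A \<le> \<alpha>) \<longleftrightarrow>
    possibility_contour T P p x \<theta> \<le> \<alpha>"
proof
  assume "\<exists>A\<subseteq>T. \<theta> \<in> A \<and> possibility_measure T P p x A \<le> \<alpha>"
  then obtain A where A: "A \<subseteq> T" "\<theta> \<in> A" "possibility_measure T P p x A \<le> \<alpha>" by blast
  \<comment> \<open>The real supremum is an upper bound only of a bounded set, whence the bound by 1.\<close>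
  have "bdd_above (possibility_contour T P p x ` A)"
    using A(1) prob_space_P
    by (intro bdd_aboveI2[of _ _ 1]) (auto simp: possibility_contour_def prob_space.prob_le_1)
  then have "possibility_contour T P p x \<theta> \<le> possibility_measure T P p x A"
    unfolding possibility_measure_def using A(2) by (intro cSUP_upper)
  then show "possibility_contour T P p x \<theta> \<le> \<alpha>" using A(3) by linarith
next
  assume "possibility_contour T P p x \<theta> \<le> \<alpha>"
  then show "\<exists>A\<subseteq>T. \<theta> \<in> A \<and> possibility_measure T P p x A \<le> \<alpha>"
    using assms by (intro exI[of _ "{\<theta>}"]) (simp add: possibility_measure_def)
qed

end

theorem mainTheorem1:
  fixes T :: "'t set" and M :: "'x measure"
    and P :: "'t \<Rightarrow> 'x measure" and p :: "'t \<Rightarrow> 'x \<Rightarrow> real"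
  assumes "statistical_model T M P p"
  shows "(\<forall>\<alpha>\<in>{0..1}.
            (\<forall>\<Theta>\<in>T. {x \<in> space (P \<Theta>). possibility_contour T P p x \<Theta> \<le> \<alpha>} \<in> sets (P \<Theta>)) \<and>
            (SUP \<Theta>\<in>T. \<P>(x in P \<Theta>. possibility_contour T P p x \<Theta> \<le> \<alpha>)) \<le> \<alpha>) \<and>
         (\<forall>\<alpha>\<in>{0..1}.
            (\<forall>\<Theta>\<in>T. {x \<in> space (P \<Theta>). \<exists>A\<subseteq>T. \<Theta> \<in> A \<and> possibility_measure T P p x A \<le> \<alpha>}
                     \<in> sets (P \<Theta>)) \<and>
            (SUP \<Theta>\<in>T. \<P>(x in P \<Theta>. \<exists>A\<subseteq>T. \<Theta> \<in> A \<and> possibility_measure T P p x A \<le> \<alpha>)) \<le> \<alpha>)"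
proof -
  interpret statistical_model T M P p by (rule assms)
  have meas: "{x \<in> space (P \<Theta>). possibility_contour T P p x \<Theta> \<le> \<alpha>} \<in> sets (P \<Theta>)"
    if "\<Theta> \<in> T" for \<Theta> \<alpha>
    using possibility_contour_measurable[OF that] by measurable
  have valid: "(SUP \<Theta>\<in>T. \<P>(x in P \<Theta>. possibility_contour T P p x \<Theta> \<le> \<alpha>)) \<le> \<alpha>"
    if "\<alpha> \<in> {0..1}" for \<alpha>
    using that T_nonempty by (intro cSUP_least prob_possibility_contour_le) auto
  show ?thesis
    using meas valid by (simp add: ex_possibility_measure_le_iff cong: SUP_cong)
qed

end
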